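(* Let $F\colon \mathbb{R}^n\rightrightarrows \mathbb{R}^p$ and $G\colon \mathbb{R}^p\rightrightarrows \mathbb{R}^q$ be nearly convex set-valued mappings such that $\mathrm{ri}(\mathrm{rge}\, F)\cap \mathrm{ri}(\mathrm{dom}\, G)\neq\emptyset$. Then for any $(\bar x,\bar z)\in\mathrm{gph}(G\circ F)$ and $w\in\mathbb{R}^q$ we have $$D^*(G\circ F)(\bar x,\bar z)(w)=\big(D^*F(\bar x,\bar y)\circ D^*G(\bar y,\bar z)\big)(w)$$ whenever $\bar y\in M(\bar x,\bar z)$, where $M(\bar x,\bar z)=F(\bar x)\cap G^{-1}(\bar z)$.
   Context: A set $\Omega\subset\mathbb{R}^k$ is nearly convex if there exists a convex set $C\subset\mathbb{R}^k$ such that $C\subset\Omega\subset\overline{C}$, where $\overline{C}$ is the closure of $C$. For an arbitrary set $\Omega\subset\mathbb{R}^k$, the relative interior is $\mathrm{ri}\,\Omega=\{a\in\Omega \mid \text{there exists } \delta>0 \text{ with } B(a;\delta)\cap \mathrm{aff}\,\Omega\subset\Omega\}$, where $\mathrm{aff}\,\Omega$ is the affine hull and $B(a;\delta)$ the open ball. A set-valued mapping $F\colon\mathbb{R}^n\rightrightarrows\mathbb{R}^p$ assigns to each $x\in\mathbb{R}^n$ a (possibly empty) subset $F(x)\subset\mathbb{R}^p$; $\mathrm{dom}\,F=\{x\mid F(x)\neq\emptyset\}$, $\mathrm{rge}\,F=\bigcup_{x}F(x)$, and $\mathrm{gph}\,F=\{(x,y)\in\mathbb{R}^n\times\mathbb{R}^p\mid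 y\in F(x)\}$. $F$ is nearly convex if $\mathrm{gph}\,F$ is a nearly convex set. Also $G^{-1}(z)=\{y\mid z\in G(y)\}$, and the composition of set-valued mappings is $(G\circ F)(x)=\bigcup_{y\in F(x)}G(y)$; under the stated hypotheses $G\circ F$ is nearly convex. The normal cone to a nearly convex set $\Omega\subset\mathbb{R}^k$ at $\bar a\in\Omega$ is $N(\bar a;\Omega)=\{w\in\mathbb{R}^k\mid \langle w,a-\bar a\rangle\le 0 \text{ for all } a\in\Omega\}$. The coderivative of a nearly convex set-valued mapping $F\colon\mathbb{R}^n\rightrightarrows\mathbb{R}^p$ at $(\bar x,\bar y)\in\mathrm{gph}\,F$ is the set-valued mapping $D^*F(\bar x,\bar y)\colon\mathbb{R}^p\rightrightarrows\mathbb{R}^n$ given by $D^*F(\bar x,\bar y)(v)=\{u\in\mathbb{R}^n\mid (u,-v)\in N((\bar x,\bar y);\mathrm{gph}\,F)\}$. *)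

theory Defs
  imports "HOL-Analysis.Analysis"
begin

definition nearly_convex :: "'a::euclidean_space set \<Rightarrow> bool" where
  "nearly_convex \<Omega> \<longleftrightarrow> (\<exists>C. convex C \<and> C \<subseteq> \<Omega> \<and> \<Omega> \<subseteq> closure C)"

text \<open>
  A set-valued mapping is a function into sets. The relative interior is the library's
  \<open>rel_interior\<close>; the theorem \<open>rel_interior_ball\<close> is its description by balls and affine hulls.
\<close>

type_synonym ('a, 'b) svmap = "'a \<Rightarrow> 'b set"

definition svm_dom :: "('a, 'b) svmap \<Rightarrow> 'a set" where
  "svm_dom F = {x. F x \<noteq> {}}"

definition svm_rge :: "('a, 'b) svmap \<Rightarrow> 'b set" where
  "svm_rge F = (\<Union>x. F x)"

definition gph :: "('a, 'b) svmap \<Rightarrow> ('a \<times> 'b) set" where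
  "gph F = {(x, y). y \<in> F x}"

definition svm_inverse :: "('a, 'b) svmap \<Rightarrow> ('b, 'a) svmap" where
  "svm_inverse G z = {y. z \<in> G y}"

definition svm_comp :: "('b, 'c) svmap \<Rightarrow> ('a, 'b) svmap \<Rightarrow> ('a, 'c) svmap"
    (infixl \<open>\<circ>\<^sub>s\<close> 55) where
  "(G \<circ>\<^sub>s F) x = (\<Union>y\<in>F x. G y)"

definition nearly_convex_svm ::
    "('a::euclidean_space, 'b::euclidean_space) svmap \<Rightarrow> bool" where
  "nearly_convex_svm F \<longleftrightarrow> nearly_convex (gph F)"

text \<open>
  The next two notions are given by total formulas; they are meant for a nearly convex set (or
  mapping) and a base point belonging to that set (or to the graph of that mapping).
\<close>

definition normal_cone :: "'a::euclidean_space \<Rightarrow> 'a set \<Rightarrow> 'a set" where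
  "normal_cone a \<Omega> = {w. \<forall>x\<in>\<Omega>. w \<bullet> (x - a) \<le> 0}"

definition coderivative ::
    "('a::euclidean_space, 'b::euclidean_space) svmap \<Rightarrow> 'a \<times> 'b \<Rightarrow> ('b, 'a) svmap" where
  "coderivative F p v = {u. (u, - v) \<in> normal_cone p (gph F)}"

end

theory Submission
  imports Defs
begin

text \<open>
  The inclusion from right to left adds two inequalities. For the other one, let \<open>C\<close> and \<open>D\<close> be convex
  with \<open>C \<subseteq> gph F \<subseteq> closure C\<close> and \<open>D \<subseteq> gph G \<subseteq> closure D\<close>, and let \<open>E\<close> be the convex set of all pairs
  \<open>(b - b', w \<bullet> (c - z) - u \<bullet> (a - x))\<close> with \<open>(a, b') \<in> C\<close> and \<open>(b, c) \<in> D\<close>. That \<open>u\<close> lies in the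
  coderivative of the composition says that \<open>(0, r) \<in> E\<close> forces \<open>r \<ge> 0\<close>, and the relative
  interior condition says that \<open>0\<close> is a relative interior point of the projection of \<open>E\<close>. Hence
  some \<open>v\<close> satisfies \<open>v \<bullet> d \<le> r\<close> for all \<open>(d, r) \<in> E\<close>. By continuity this inequality persists
  on the two graphs, and fixing one of the two points at \<open>(y, z)\<close> or \<open>(x, y)\<close> yields the
  two coderivative inequalities.
\<close>

text \<open>In the closure of \<open>S\<close>, the point lies on the relative frontier, and a
  supporting hyperplane there is strict on the nonempty relative interior. Outside the closure,
  strict separation applies.\<close>

lemma proper_separation_point:
  fixes S :: "'a::euclidean_space set"
  assumes "convex S" "S \<noteq> {}" "p \<notin> rel_interior S"
  obtains a where "\<And>s. s \<in> S \<Longrightarrow> a \<bullet> p \<le> a \<bullet> s" "\<exists>s\<in>S. a \<bullet> p < a \<bullet> s"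
proof (cases "p \<in> closure S")
  case True
  obtain a where a: "\<And>s. s \<in> closure S \<Longrightarrow> a \<bullet> p \<le> a \<bullet> s"
    "\<And>s. s \<in> rel_interior S \<Longrightarrow> a \<bullet> p < a \<bullet> s"
    using supporting_hyperplane_relative_frontier[OF assms(1) True assms(3)] by metis
  have "rel_interior S \<noteq> {}"
    using assms rel_interior_eq_empty by blast
  then show thesis
    using a that closure_subset rel_interior_subset by (metis equals0I subset_iff)
next
  case False
  then obtain a b where ab: "a \<bullet> p < b" "\<forall>s\<in>closure S. b < a \<bullet> s"
    using separating_hyperplane_closed_point[of "closure S" p] assms(1) by auto
  then have "a \<bullet> p < a \<bullet> s" if "s \<in> S" for s
    using that closure_subset[of S] by force
  then show thesis
    using that[of a] assms(2) by (metis all_not_in_conv less_imp_le)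
qed

text \<open>The origin is properly separated from the upward closure \<open>U\<close> of
  \<open>E\<close>. The normal \<open>(a, b)\<close> turns out to have \<open>b > 0\<close>, so the
  hyperplane is not vertical and \<open>v = - a / b\<close> is its slope.\<close>

lemma subgradient_exists:
  fixes E :: "('a::euclidean_space \<times> real) set"
  assumes E: "convex E" and ri: "0 \<in> rel_interior (fst ` E)"
    and pos: "\<And>r. (0, r) \<in> E \<Longrightarrow> 0 \<le> r"
  obtains v where "\<And>d r. (d, r) \<in> E \<Longrightarrow> v \<bullet> d \<le> r"
proof -
  define U where "U = {(d, r). \<exists>s\<le>r. (d, s) \<in> E}"
  have "U = (\<lambda>((d, s), t). (d, s + t)) ` (E \<times> {0..})"
  proof -
    have "(d, r) \<in> (\<lambda>((d, s), t). (d, s + t)) ` (E \<times> {0..})" if "s \<le> r" "(d, s) \<in> E" for d r s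
      using that by (intro image_eqI[where x = "((d, s), r - s)"]) auto
    then have "U \<subseteq> (\<lambda>((d, s), t). (d, s + t)) ` (E \<times> {0..})"
      by (auto simp only: U_def)
    moreover have "(\<lambda>((d, s), t). (d, s + t)) ` (E \<times> {0..}) \<subseteq> U"
      by (auto simp: U_def) (metis le_add_same_cancel1)
    ultimately show ?thesis
      by blast
  qed
  moreover have "linear (\<lambda>((d :: 'a, s :: real), t). (d, s + t))"
    by (rule linearI) (auto simp: algebra_simps)
  ultimately have U: "convex U"
    using convex_linear_image convex_Times E convex_real_interval(1) by metis
  obtain r where r: "(0, r) \<in> E"
    using ri rel_interior_subset by fastforce
  \<comment> \<open>The maximum makes the height strictly positive. This drives both the next
    contradiction and the sign of \<open>b\<close>.\<close>
  then have U1: "(0, max r 1) \<in> U"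
    using max.cobounded1 by (auto simp only: U_def)
  have "0 \<notin> rel_interior U"
  proof
    \<comment> \<open>The segment from \<open>(0, max r 1)\<close> to the origin could then be
      prolonged within \<open>U\<close>, to a point of negative height above 0, against
      \<open>pos\<close>.\<close>
    assume "0 \<in> rel_interior U"
    then obtain e where e: "e > 1" "(1 - e) *\<^sub>R (0, max r 1) + e *\<^sub>R 0 \<in> U"
      using convex_rel_interior_iff[OF U] U1 by blast
    then obtain s where "s \<le> (1 - e) * max r 1" "(0, s) \<in> E"
      by (auto simp: U_def)
    moreover have "(1 - e) * max r 1 < 0"
      using e(1) by (simp add: mult_neg_pos)
    ultimately show False
      using pos by fastforce
  qed
  then obtain ab where ab: "\<And>s. s \<in> U \<Longrightarrow> ab \<bullet> 0 \<le> ab \<bullet> s" "\<exists>s\<in>U. ab \<bullet> 0 < ab \<bullet> s"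
    using proper_separation_point[OF U] U1 by blast
  obtain a b where "ab = (a, b)"
    by fastforce
  with ab have sep: "\<And>d r. (d, r) \<in> U \<Longrightarrow> 0 \<le> a \<bullet> d + b * r"
    and strict: "\<exists>(d, r)\<in>U. 0 < a \<bullet> d + b * r"
    by (auto simp: split_beta) force
  have "b \<ge> 0"
  proof (rule ccontr)
    assume b: "\<not> b \<ge> 0"
    have "0 \<le> b * max r 1"
      using sep[OF U1] by simp
    moreover have "b * max r 1 < 0"
      using b by (simp add: mult_neg_pos)
    ultimately show False
      by linarith
  qed
  moreover have "b \<noteq> 0"
  proof
    assume b: "b = 0"
    obtain d s where d: "(d, s) \<in> E" "0 < a \<bullet> d"
      using strict b by (auto simp: U_def)
    have "convex (fst ` E)"
      by (intro convex_linear_image E linear_fst)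
    then obtain e where "e > 1" "(1 - e) *\<^sub>R d + e *\<^sub>R 0 \<in> fst ` E"
      using convex_rel_interior_iff[of "fst ` E" 0] ri d(1) by force
    moreover from this have "0 \<le> a \<bullet> ((1 - e) *\<^sub>R d + e *\<^sub>R 0)"
      using sep b by (force simp: U_def)
    moreover have "(1 - e) * (a \<bullet> d) < 0"
      using \<open>e > 1\<close> d(2) by (simp add: mult_neg_pos)
    ultimately show False
      by simp
  qed
  ultimately have "b > 0"
    by simp
  have "(- (1 / b) *\<^sub>R a) \<bullet> d \<le> s" if "(d, s) \<in> E" for d s
  proof -
    have "0 \<le> a \<bullet> d + b * s"
      using sep that by (auto simp: U_def)
    then show ?thesis
      using \<open>b > 0\<close> by (simp add: field_simps)
  qed
  then show thesis
    using that by blast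
qed

text \<open>All three sets have the same affine hull, and a convex set shares its relative interior
  with its closure. This carries the hypothesis from the range and domain over to projections of
  convex sets.\<close>

lemma rel_interior_subset_if_between:
  fixes P S :: "'a::euclidean_space set"
  assumes "convex P" "P \<subseteq> S" "S \<subseteq> closure P"
  shows "rel_interior S \<subseteq> rel_interior P"
proof -
  have "affine hull S = affine hull (closure P)"
    using assms by (metis closure_same_affine_hull hull_mono subset_antisym)
  then have "rel_interior S \<subseteq> rel_interior (closure P)"
    using assms(3) subset_rel_interior by blast
  then show ?thesis
    by (simp add: assms(1) convex_rel_interior_closure)
qed

lemma rel_interior_differences:
  fixes P Q :: "'a::euclidean_space set"
  assumes "convex P" "convex Q" "rel_interior P \<inter> rel_interior Q \<noteq> {}"
  shows "0 \<in> rel_interior ((\<lambda>(p, q). q - p) ` (P \<times> Q))"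
proof -
  have "linear (\<lambda>(p :: 'a, q). q - p)"
    by (rule linearI) (auto simp: algebra_simps)
  then have "rel_interior ((\<lambda>(p, q). q - p) ` (P \<times> Q))
      = (\<lambda>(p, q). q - p) ` (rel_interior P \<times> rel_interior Q)"
    using rel_interior_convex_linear_image[of _ "P \<times> Q"] assms convex_Times rel_interior_Times
    by metis
  then show ?thesis
    using assms(3) by force
qed

lemma mem_coderivative_iff:
  "u \<in> coderivative F (x, y) v
    \<longleftrightarrow> (\<forall>a b. b \<in> F a \<longrightarrow> u \<bullet> (a - x) - v \<bullet> (b - y) \<le> 0)"
  by (auto simp: coderivative_def normal_cone_def gph_def)

lemma coderivative_comp_superset:
  "(coderivative F (x, y) \<circ>\<^sub>s coderivative G (y, z)) w
    \<subseteq> coderivative (G \<circ>\<^sub>s F) (x, z) w"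
  unfolding svm_comp_def mem_coderivative_iff subset_iff by (fastforce simp: mem_coderivative_iff)

lemma coderivative_comp_subset:
  fixes F :: "('a::euclidean_space, 'b::euclidean_space) svmap"
    and G :: "('b, 'c::euclidean_space) svmap"
  assumes F: "nearly_convex_svm F" and G: "nearly_convex_svm G"
    and ri: "rel_interior (svm_rge F) \<inter> rel_interior (svm_dom G) \<noteq> {}"
    and y: "y \<in> F x" and z: "z \<in> G y"
  shows "coderivative (G \<circ>\<^sub>s F) (x, z) w
    \<subseteq> (coderivative F (x, y) \<circ>\<^sub>s coderivative G (y, z)) w"
proof
  fix u assume u: "u \<in> coderivative (G \<circ>\<^sub>s F) (x, z) w"
  obtain C where C: "convex C" "C \<subseteq> gph F" "gph F \<subseteq> closure C"
    using F unfolding nearly_convex_svm_def nearly_convex_def by blast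
  obtain D where D: "convex D" "D \<subseteq> gph G" "gph G \<subseteq> closure D"
    using G unfolding nearly_convex_svm_def nearly_convex_def by blast
  have rge: "svm_rge F = snd ` gph F" and dom: "svm_dom G = fst ` gph G"
    by (force simp: svm_rge_def svm_dom_def gph_def)+
  have convex: "convex (snd ` C)" "convex (fst ` D)"
    using C(1) D(1) convex_linear_image linear_fst linear_snd by blast+
  have "snd ` gph F \<subseteq> closure (snd ` C)" "fst ` gph G \<subseteq> closure (fst ` D)"
    using C(3) D(3) closure_linear_image_subset[OF linear_snd, of C]
      closure_linear_image_subset[OF linear_fst, of D] by blast+
  then have "rel_interior (svm_rge F) \<subseteq> rel_interior (snd ` C)"
    "rel_interior (svm_dom G) \<subseteq> rel_interior (fst ` D)"
    unfolding rge dom using rel_interior_subset_if_between convex C(2) D(2)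
    by (metis image_mono)+
  with ri have ri': "rel_interior (snd ` C) \<inter> rel_interior (fst ` D) \<noteq> {}"
    by blast

  \<comment> \<open>The linear part is split from the constant
    \<open>u \<bullet> x - w \<bullet> z\<close>, so that \<open>E\<close> is a translated linear
    image of a convex product.\<close>
  define L where "L = (\<lambda>(c :: 'a \<times> 'b, d :: 'b \<times> 'c). (fst d - snd c, w \<bullet> snd d - u \<bullet> fst c))"
  define E where "E = (\<lambda>p. (0, u \<bullet> x - w \<bullet> z) + p) ` L ` (C \<times> D)"
  have "linear L"
    unfolding L_def by (rule linearI) (auto simp: algebra_simps inner_simps)
  then have E: "convex E"
    unfolding E_def by (intro convex_translation convex_linear_image convex_Times C D)
  have "fst ` E = (\<lambda>(p, q). q - p) ` (snd ` C \<times> fst ` D)"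
    unfolding E_def L_def by (force simp: image_iff)
  then have riE: "0 \<in> rel_interior (fst ` E)"
    using rel_interior_differences[OF convex ri'] by simp
  have pos: "0 \<le> r" if r: "(0, r) \<in> E" for r
  proof -
    \<comment> \<open>A zero first coordinate means that the two points share their middle component
      \<open>b\<close> and hence compose.\<close>
    obtain a b c where abc: "(a, b) \<in> C" "(b, c) \<in> D" "r = w \<bullet> (c - z) - u \<bullet> (a - x)"
      using r by (auto simp: E_def L_def inner_diff_right)
    then have "c \<in> (G \<circ>\<^sub>s F) a"
      using C(2) D(2) by (auto simp: gph_def svm_comp_def)
    then show ?thesis
      using u abc(3) by (fastforce simp: mem_coderivative_iff)
  qed
  obtain v where v: "\<And>d r. (d, r) \<in> E \<Longrightarrow> v \<bullet> d \<le> r"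
    using subgradient_exists[OF E riE pos] by blast
  define f where "f = (\<lambda>p :: ('a \<times> 'b) \<times> ('b \<times> 'c). v \<bullet> (fst (snd p) - snd (fst p))
      - (w \<bullet> (snd (snd p) - z) - u \<bullet> (fst (fst p) - x)))"
  have "f p \<le> 0" if "p \<in> C \<times> D" for p
  proof -
    have "(fst (snd p) - snd (fst p), w \<bullet> (snd (snd p) - z) - u \<bullet> (fst (fst p) - x)) \<in> E"
      using that by (force simp: E_def L_def inner_simps image_iff)
    then show ?thesis
      using v by (simp add: f_def)
  qed
  moreover have "continuous_on (closure (C \<times> D)) f"
    unfolding f_def by (intro continuous_intros)
  ultimately have f: "f p \<le> 0" if "p \<in> gph F \<times> gph G" for p
    using continuous_le_on_closure[of "C \<times> D" f p 0] that C(3) D(3)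
    unfolding closure_Times by blast
  have "u \<bullet> (a - x) - v \<bullet> (b - y) \<le> 0" if "b \<in> F a" for a b
    using f[of "((a, b), (y, z))"] that z by (simp add: gph_def f_def inner_diff_right)
  moreover have "v \<bullet> (b - y) - w \<bullet> (c - z) \<le> 0" if "c \<in> G b" for b c
    using f[of "((x, y), (b, c))"] that y by (simp add: gph_def f_def)
  ultimately have "u \<in> coderivative F (x, y) v" "v \<in> coderivative G (y, z) w"
    unfolding mem_coderivative_iff by blast+
  then show "u \<in> (coderivative F (x, y) \<circ>\<^sub>s coderivative G (y, z)) w"
    by (auto simp: svm_comp_def)
qed

theorem theorem5p6:
  fixes F :: "(real ^ 'n, real ^ 'p) svmap"
    and G :: "(real ^ 'p, real ^ 'q) svmap"
    and x :: "real ^ 'n" and y :: "real ^ 'p" and z w :: "real ^ 'q"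
  assumes "nearly_convex_svm F"
    and "nearly_convex_svm G"
    and "rel_interior (svm_rge F) \<inter> rel_interior (svm_dom G) \<noteq> {}"
    and "(x, z) \<in> gph (G \<circ>\<^sub>s F)"
    and "y \<in> F x \<inter> svm_inverse G z"
  shows "coderivative (G \<circ>\<^sub>s F) (x, z) w
    = (coderivative F (x, y) \<circ>\<^sub>s coderivative G (y, z)) w"
proof -
  have "y \<in> F x" "z \<in> G y"
    using assms(5) by (auto simp: svm_inverse_def)
  then show ?thesis
    using assms coderivative_comp_subset coderivative_comp_superset
    by (intro subset_antisym)
qed

end
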